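(* Let $g$ be a real-coefficient polynomial having only one real zero $\alpha$, and let $f_a(x)=a g(x)$ for $a\in\mathbb{R}$. (A) If $\alpha>0$, then there exists $N>0$ such that for every $a\in\mathbb{R}$ with $|a|>N$ and $f_a(x)\ge0$ for all $x\in\mathbb{R}$, there exists a hyperbolic invariant set $\Lambda_a\subset(0,\alpha)\cup(\alpha,+\infty)$ for $f_a$ such that $f_a:\Lambda_a\to\Lambda_a$ is topologically conjugate to $\sigma:\Sigma_2\to\Sigma_2$. (B) If $\alpha<0$, then there exists $N>0$ such that for every $a\in\mathbb{R}$ with $|a|>N$ and $f_a(x)\le0$ for all $x\in\mathbb{R}$, there exists a hyperbolic invariant set $\Lambda_a\subset(-\infty,\alpha)\cup(\alpha,0)$ for $f_a$ such that $f_a:\Lambda_a\to\Lambda_a$ is topologically conjugate to $\sigma:\Sigma_2\to\Sigma_2$.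
   Context: The real zero $\alpha$ of $g$ may have any multiplicity ("only one real zero" means exactly one distinct real zero). A set $\Lambda$ is invariant for $f$ if $f(\Lambda)=\Lambda$. For a $C^1$ map $f:\mathbb{R}\to\mathbb{R}$, a compact invariant set $\Lambda$ is a hyperbolic (invariant) set for $f$ if there are constants $C>0$ and $\lambda>1$ such that $|(f^n)'(x)|\ge C\lambda^n$ for all $x\in\Lambda$ and all $n\ge1$, where $f^n$ is the $n$-fold iterate. $\Sigma_2=\{(s_0,s_1,s_2,\dots): s_i\in\{1,2\}\}$ is the one-sided sequence space on two symbols with the metric $d(s,t)=\sum_{i\ge0}\delta(s_i,t_i)/2^i$ ($\delta(s_i,t_i)=1$ if $s_i\ne t_i$ and $0$ otherwise), and $\sigma(s_0,s_1,s_2,\dots)=(s_1,s_2,\dots)$ is the shift map. *)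

theory Defs
  imports
    "HOL-Analysis.Analysis"
    "HOL-Computational_Algebra.Polynomial"
begin

definition scaled_poly :: "real poly \<Rightarrow> real \<Rightarrow> real \<Rightarrow> real" where
  "scaled_poly g a = (\<lambda>x. a * poly g x)"

definition invariant_set :: "('a \<Rightarrow> 'a) \<Rightarrow> 'a set \<Rightarrow> bool" where
  "invariant_set f \<Lambda> \<longleftrightarrow> f ` \<Lambda> = \<Lambda>"

definition hyperbolic_set :: "(real \<Rightarrow> real) \<Rightarrow> real set \<Rightarrow> bool" where
  "hyperbolic_set f \<Lambda> \<longleftrightarrow>
     f C1_differentiable_on UNIV \<and> compact \<Lambda> \<and> invariant_set f \<Lambda> \<and>
     (\<exists>C \<mu>::real. C > 0 \<and> \<mu> > 1 \<and>
        (\<forall>x\<in>\<Lambda>. \<forall>n\<ge>1. \<bar>deriv (f ^^ n) x\<bar> \<ge> C * \<mu> ^ n))"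

definition Sigma2 :: "(nat \<Rightarrow> nat) set" where
  "Sigma2 = {s. \<forall>i. s i \<in> {1, 2}}"

definition seq_dist :: "(nat \<Rightarrow> nat) \<Rightarrow> (nat \<Rightarrow> nat) \<Rightarrow> real" where
  "seq_dist s t = (\<Sum>i. (if s i \<noteq> t i then 1 else 0) / 2 ^ i)"

definition shift :: "(nat \<Rightarrow> 'a) \<Rightarrow> (nat \<Rightarrow> 'a)" where
  "shift s = (\<lambda>i. s (Suc i))"

lemma seq_dist_summable:
  "summable (\<lambda>i. (if s i \<noteq> t i then 1 else 0) / 2 ^ i :: real)"
proof (rule summable_comparison_test')
  show "summable (\<lambda>i. (1/2) ^ i :: real)"
    by (rule summable_geometric) simp
qed (auto simp: power_one_over)

lemma Metric_space_Sigma2: "Metric_space Sigma2 seq_dist"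
proof
  fix s t :: "nat \<Rightarrow> nat"
  show "0 \<le> seq_dist s t"
    unfolding seq_dist_def by (rule suminf_nonneg[OF seq_dist_summable]) simp
  show "seq_dist s t = seq_dist t s"
    unfolding seq_dist_def by (intro arg_cong[where f = suminf] ext) auto
  have "seq_dist s t = 0 \<longleftrightarrow> (\<forall>i. (if s i \<noteq> t i then 1 else 0) / 2 ^ i = (0::real))"
    unfolding seq_dist_def by (rule suminf_eq_zero_iff[OF seq_dist_summable]) simp
  then show "seq_dist s t = 0 \<longleftrightarrow> s = t"
    by (auto split: if_splits)
next
  fix s t u :: "nat \<Rightarrow> nat"
  have "seq_dist s u \<le>
      (\<Sum>i. (if s i \<noteq> t i then 1 else 0) / 2 ^ i + (if t i \<noteq> u i then 1 else 0) / 2 ^ i)"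
    unfolding seq_dist_def
    by (intro suminf_le summable_add seq_dist_summable) (auto simp: field_simps)
  also have "\<dots> = seq_dist s t + seq_dist t u"
    unfolding seq_dist_def by (intro suminf_add[symmetric] seq_dist_summable)
  finally show "seq_dist s u \<le> seq_dist s t + seq_dist t u" .
qed

definition Sigma2_topology :: "(nat \<Rightarrow> nat) topology" where
  "Sigma2_topology = Metric_space.mtopology Sigma2 seq_dist"

lemma topspace_Sigma2_topology [simp]: "topspace Sigma2_topology = Sigma2"
  by (simp add: Sigma2_topology_def Metric_space.topspace_mtopology[OF Metric_space_Sigma2])

definition topologically_conjugate ::
    "'a topology \<Rightarrow> ('a \<Rightarrow> 'a) \<Rightarrow> 'b topology \<Rightarrow> ('b \<Rightarrow> 'b) \<Rightarrow> bool" where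
  "topologically_conjugate X f Y g \<longleftrightarrow>
     f \<in> topspace X \<rightarrow> topspace X \<and> g \<in> topspace Y \<rightarrow> topspace Y \<and>
     (\<exists>h. homeomorphic_map X Y h \<and> (\<forall>x\<in>topspace X. h (f x) = g (h x)))"

end

theory Submission
  imports Defs
begin

text \<open>
  Write \<open>f = a * g\<close>.  The invariant set lives close to the zero \<open>\<alpha>\<close>, on both sides of it.
  Scaling \<open>g\<close> does not change its logarithmic derivative \<open>f'/f = g'/g\<close>, and this
  behaves like \<open>k / (x - \<alpha>)\<close> near \<open>\<alpha>\<close>, where \<open>k\<close> is the multiplicity of the zero.  So fix once
  and for all a small window \<open>W = [\<alpha> - \<delta>, \<alpha> + \<delta>]\<close>, with \<open>\<delta>\<close> small compared with \<open>\<bar>\<alpha>\<bar>\<close>.  A point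
  of \<open>W\<close> whose image lies in \<open>W\<close> again has \<open>\<bar>f x\<bar> \<ge> \<bar>\<alpha>\<bar> - \<delta>\<close>, and therefore
  \<open>\<bar>f' x\<bar> \<ge> (\<bar>\<alpha>\<bar> - \<delta>) / (2 * \<delta>)\<close>, a bound independent of \<open>a\<close> which exceeds \<open>1\<close>:
  expansion comes for free from the choice of \<open>\<delta>\<close> (\<open>horseshoe_at_zero\<close>).

  The size of \<open>a\<close> is needed only for the covering property.  Since \<open>f\<close> never has the sign opposite
  to \<open>\<alpha>\<close>, vanishes at \<open>\<alpha>\<close> and is huge in absolute value at \<open>\<alpha> \<plusminus> \<delta>\<close>, each half of \<open>W\<close> is
  mapped over all of \<open>W\<close>.  As \<open>f \<alpha> = 0\<close> is outside \<open>W\<close>, the parts of the two halves that return to \<open>W\<close> are disjoint compact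
  sets, each mapped expandingly over both: a horseshoe.  The set of points whose whole
  orbit stays in the horseshoe is then coded by itineraries: expansion makes the code
  injective, covering and compactness make it surjective, and a continuous bijection from a
  compact space to a Hausdorff space is a homeomorphism.

  Both cases \<open>\<alpha> > 0\<close>, \<open>f \<ge> 0\<close> and \<open>\<alpha> < 0\<close>, \<open>f \<le> 0\<close> say that \<open>\<alpha> * f x\<close> is never negative, and they are
  treated together in this form (\<open>large_multiples_have_horseshoe\<close>).
\<close>

section \<open>Coding an expanding horseshoe by the full shift\<close>

lemma seq_dist_le:
  assumes "\<And>i. i < n \<Longrightarrow> s i = t i"
  shows "seq_dist s t \<le> 2 * (1/2) ^ n"
proof -
  let ?d = "\<lambda>i. (if s i \<noteq> t i then 1 else 0) / 2 ^ i :: real"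
  have geo: "summable (\<lambda>i. (1/2::real) ^ i)"
    by (rule summable_geometric) simp
  have "seq_dist s t = (\<Sum>i. ?d (i + n)) + (\<Sum>i<n. ?d i)"
    unfolding seq_dist_def by (rule suminf_split_initial_segment[OF seq_dist_summable])
  also have "(\<Sum>i<n. ?d i) = 0"
    using assms by simp
  also have "(\<Sum>i. ?d (i + n)) \<le> (\<Sum>i. (1/2) ^ n * (1/2) ^ i)"
  proof (rule suminf_le)
    show "summable (\<lambda>i. ?d (i + n))"
      using seq_dist_summable by (subst summable_iff_shift)
    show "summable (\<lambda>i. (1/2) ^ n * (1/2::real) ^ i)"
      by (rule summable_mult[OF geo])
  qed (simp add: power_add power_one_over field_simps)
  also have "\<dots> = (1/2) ^ n * (\<Sum>i. (1/2) ^ i)"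
    by (rule suminf_mult[OF geo])
  also have "(\<Sum>i. (1/2::real) ^ i) = 2"
    by (simp add: suminf_geometric)
  finally show ?thesis by simp
qed

locale horseshoe =
  fixes f :: "'a::heine_borel \<Rightarrow> 'a" and J :: "nat \<Rightarrow> 'a set" and \<mu> :: real
  assumes continuous: "continuous_on UNIV f"
    and compact_piece: "i \<in> {1, 2} \<Longrightarrow> compact (J i)"
    and disjoint: "J 1 \<inter> J 2 = {}"
    and nonempty: "J 1 \<union> J 2 \<noteq> {}"
    and covers: "i \<in> {1, 2} \<Longrightarrow> J 1 \<union> J 2 \<subseteq> f ` J i"
    and expands: "i \<in> {1, 2} \<Longrightarrow> x \<in> J i \<Longrightarrow> y \<in> J i \<Longrightarrow> \<mu> * dist x y \<le> dist (f x) (f y)"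
    and rate: "1 < \<mu>"
begin

definition trapped :: "'a set" where
  "trapped = {x. \<forall>n. (f ^^ n) x \<in> J 1 \<union> J 2}"

definition itinerary :: "'a \<Rightarrow> nat \<Rightarrow> nat" where
  "itinerary x = (\<lambda>n. if (f ^^ n) x \<in> J 1 then 1 else 2)"

lemma continuous_iterate: "continuous_on UNIV (f ^^ n)"
proof (induction n)
  case (Suc n)
  then show ?case
    using continuous_on_compose[OF Suc continuous_on_subset[OF continuous]]
    by (simp add: comp_def)
qed (simp add: id_def)

lemma iterate_shift: "(f ^^ n) (f x) = (f ^^ Suc n) x"
  by (simp add: funpow_swap1)

lemma closed_iterate_vimage:
  assumes "closed S"
  shows "closed {x. (f ^^ n) x \<in> S}"
  using closed_vimage[OF assms continuous_iterate[of n]] by (simp add: vimage_def)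

lemma compact_pieces: "compact (J 1 \<union> J 2)"
  by (simp add: compact_Un compact_piece)

lemma trapped_subset: "trapped \<subseteq> J 1 \<union> J 2"
proof
  fix x assume "x \<in> trapped"
  then have "(f ^^ 0) x \<in> J 1 \<union> J 2" unfolding trapped_def by blast
  then show "x \<in> J 1 \<union> J 2" by simp
qed

lemma trappedI:
  assumes "x \<in> J 1 \<union> J 2" and "f x \<in> trapped"
  shows "x \<in> trapped"
  unfolding trapped_def
proof (intro CollectI allI)
  fix n
  show "(f ^^ n) x \<in> J 1 \<union> J 2"
  proof (cases n)
    case (Suc m)
    then show ?thesis
      using assms(2) unfolding trapped_def Suc iterate_shift[symmetric] by blast
  qed (use assms(1) in simp)
qed

lemma image_in_trapped:
  assumes "x \<in> trapped"
  shows "f x \<in> trapped"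
  unfolding trapped_def
proof (intro CollectI allI)
  fix n
  have "(f ^^ Suc n) x \<in> J 1 \<union> J 2"
    using assms unfolding trapped_def by blast
  then show "(f ^^ n) (f x) \<in> J 1 \<union> J 2"
    by (simp only: iterate_shift)
qed

lemma image_trapped: "f ` trapped = trapped"
proof
  show "f ` trapped \<subseteq> trapped"
    using image_in_trapped by blast
  show "trapped \<subseteq> f ` trapped"
  proof
    fix x assume x: "x \<in> trapped"
    then obtain y where "y \<in> J 1" "x = f y"
      using trapped_subset covers[of 1] by blast
    with x show "x \<in> f ` trapped"
      using trappedI by blast
  qed
qed

lemma compact_trapped: "compact trapped"
proof -
  have "closed (\<Inter>n. {x. (f ^^ n) x \<in> J 1 \<union> J 2})"
    by (intro closed_INT ballI closed_iterate_vimage compact_imp_closed[OF compact_pieces])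
  moreover have "(\<Inter>n. {x. (f ^^ n) x \<in> J 1 \<union> J 2}) = trapped"
    unfolding trapped_def by auto
  ultimately show ?thesis
    using compact_Int_closed[OF compact_pieces, of trapped] trapped_subset
    by (simp add: Int_absorb1)
qed

lemma itinerary_in_Sigma2: "itinerary x \<in> Sigma2"
  by (auto simp: itinerary_def Sigma2_def)

lemma itinerary_image: "itinerary (f x) = shift (itinerary x)"
  unfolding itinerary_def shift_def iterate_shift ..

lemma iterate_in_piece:
  assumes "x \<in> trapped"
  shows "(f ^^ n) x \<in> J (itinerary x n)"
  using assms unfolding trapped_def itinerary_def by auto

lemma itinerary_eqI:
  assumes "s \<in> Sigma2" and "\<And>n. (f ^^ n) x \<in> J (s n)"
  shows "itinerary x = s"
proof
  fix n
  have "s n = 1 \<or> s n = 2"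
    using assms(1) by (auto simp: Sigma2_def)
  then show "itinerary x n = s n"
    using assms(2)[of n] disjoint by (auto simp: itinerary_def)
qed

text \<open>Two orbits with the same itinerary separate at rate \<open>\<mu> ^ n\<close> but stay in a bounded set.\<close>

lemma itinerary_inj: "inj_on itinerary trapped"
proof
  fix x y
  assume x: "x \<in> trapped" and y: "y \<in> trapped" and eq: "itinerary x = itinerary y"
  have grow: "\<mu> ^ n * dist x y \<le> dist ((f ^^ n) x) ((f ^^ n) y)" for n
  proof (induction n)
    case (Suc n)
    have "\<mu> ^ Suc n * dist x y \<le> \<mu> * dist ((f ^^ n) x) ((f ^^ n) y)"
      using Suc rate by (simp add: mult.assoc)
    also have "\<dots> \<le> dist (f ((f ^^ n) x)) (f ((f ^^ n) y))"
    proof (rule expands)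
      show "itinerary x n \<in> {1, 2}"
        by (simp add: itinerary_def)
      show "(f ^^ n) x \<in> J (itinerary x n)" "(f ^^ n) y \<in> J (itinerary x n)"
        using iterate_in_piece[OF x] iterate_in_piece[OF y] eq by simp_all
    qed
    finally show ?case by simp
  qed simp
  obtain B where B: "\<And>u v. u \<in> J 1 \<union> J 2 \<Longrightarrow> v \<in> J 1 \<union> J 2 \<Longrightarrow> dist u v \<le> B"
    using compact_imp_bounded[OF compact_pieces] by (meson bounded_two_points)
  have bound: "\<mu> ^ n * dist x y \<le> B" for n
    using grow[of n] B[of "(f ^^ n) x" "(f ^^ n) y"] x y by (force simp: trapped_def)
  show "x = y"
  proof (rule ccontr)
    assume "x \<noteq> y"
    then have pos: "0 < dist x y" by simp
    obtain n where "B / dist x y < \<mu> ^ n"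
      using real_arch_pow[OF rate] by blast
    with bound[of n] pos show False
      by (simp add: field_simps)
  qed
qed

text \<open>
  The cylinder of all points following \<open>s\<close> for \<open>n\<close> further steps is nonempty because the
  covering property lets one pull back through the pieces \<open>J (s 0)\<close>, \<open>J (s 1)\<close>, and so on; by
  compactness the nested cylinders have a common point.
\<close>

lemma itinerary_surj:
  assumes s: "s \<in> Sigma2"
  obtains x where "x \<in> trapped" and "itinerary x = s"
proof -
  define cyl where "cyl s n = {x. \<forall>k\<le>n. (f ^^ k) x \<in> J (s k)}" for s :: "nat \<Rightarrow> nat" and n
  have sym: "s k \<in> {1, 2}" if "s \<in> Sigma2" for s :: "nat \<Rightarrow> nat" and k
    using that by (auto simp: Sigma2_def)
  have piece_ne: "J i \<noteq> {}" if "i \<in> {1, 2}" for i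
    using covers[OF that] nonempty by auto
  have ne: "cyl s n \<noteq> {}" if "s \<in> Sigma2" for s n
    using that
  proof (induction n arbitrary: s)
    case 0
    then show ?case
      using piece_ne[OF sym[OF 0, of 0]] by (auto simp: cyl_def)
  next
    case (Suc n)
    have "shift s \<in> Sigma2"
      using Suc.prems by (auto simp: shift_def Sigma2_def)
    then obtain y where y: "y \<in> cyl (shift s) n"
      using Suc.IH by blast
    then have "y \<in> J (s 1)"
      unfolding cyl_def shift_def by (auto dest: spec[of _ 0])
    then have "y \<in> J 1 \<union> J 2"
      using sym[OF Suc.prems, of 1] by auto
    then obtain x where x: "x \<in> J (s 0)" "f x = y"
      using covers[OF sym[OF Suc.prems, of 0]] by blast
    have "(f ^^ k) x \<in> J (s k)" if "k \<le> Suc n" for k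
    proof (cases k)
      case (Suc m)
      then show ?thesis
        using y x that iterate_shift[of m x] unfolding cyl_def shift_def by auto
    qed (use x in simp)
    then show ?case
      unfolding cyl_def by blast
  qed
  have "compact (cyl s n)" for n
  proof -
    have "closed (\<Inter>k\<in>{..n}. {x. (f ^^ k) x \<in> J (s k)})"
      using compact_piece[OF sym[OF s]]
      by (intro closed_INT ballI closed_iterate_vimage compact_imp_closed)
    moreover have "(\<Inter>k\<in>{..n}. {x. (f ^^ k) x \<in> J (s k)}) = cyl s n"
      by (auto simp: cyl_def)
    moreover have "cyl s n \<subseteq> J (s 0)"
      by (auto simp: cyl_def dest: spec[of _ 0])
    ultimately show ?thesis
      using compact_Int_closed[OF compact_piece[OF sym[OF s, of 0]], of "cyl s n"]
      by (simp add: Int_absorb1)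
  qed
  moreover have "cyl s n \<subseteq> cyl s m" if "m \<le> n" for m n
    using that by (auto simp: cyl_def)
  ultimately have "\<Inter>(range (cyl s)) \<noteq> {}"
    using ne[OF s] by (intro compact_nest) auto
  then obtain x where "\<And>n. x \<in> cyl s n" by blast
  then have x: "(f ^^ n) x \<in> J (s n)" for n
    unfolding cyl_def by blast
  show thesis
  proof
    show "itinerary x = s"
      using itinerary_eqI[OF s x] .
    have "J (s n) \<subseteq> J 1 \<union> J 2" for n
      using sym[OF s, of n] by auto
    then show "x \<in> trapped"
      using x unfolding trapped_def by blast
  qed
qed

text \<open>
  Inside \<open>trapped\<close> the condition that the \<open>k\<close>-th iterate lies in a given piece is open, since the
  other piece is closed; so each single symbol of the itinerary is locally constant.
\<close>

lemma itinerary_continuous: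
  "continuous_map (top_of_set trapped) Sigma2_topology itinerary"
  unfolding Sigma2_topology_def Metric_space.continuous_map_to_metric[OF Metric_space_Sigma2]
proof (intro ballI allI impI)
  fix x and \<epsilon> :: real
  assume "x \<in> topspace (top_of_set trapped)" and \<epsilon>: "0 < \<epsilon>"
  then have x: "x \<in> trapped" by simp
  obtain n where "(1/2::real) ^ n < \<epsilon> / 2"
    using real_arch_pow_inv[of "\<epsilon> / 2" "1/2"] \<epsilon> by auto
  then have n: "2 * (1/2) ^ n < \<epsilon>" by simp
  define U where "U = (\<Inter>k\<in>{..<n}. {y. (f ^^ k) y \<in> - J (3 - itinerary x k)})"
  have "open {y. (f ^^ k) y \<in> - J (3 - itinerary x k)}" for k
  proof -
    have "closed (J (3 - itinerary x k))"
      by (intro compact_imp_closed compact_piece) (auto simp: itinerary_def)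
    from closed_iterate_vimage[OF this, of k] show ?thesis
      by (simp add: closed_def Collect_neg_eq)
  qed
  then have "open U"
    unfolding U_def by (intro open_INT) auto
  \<comment> \<open>the symbol other than \<open>i\<close> is \<open>3 - i\<close>\<close>
  have other: "(f ^^ k) y \<notin> J (3 - itinerary x k) \<longleftrightarrow> itinerary y k = itinerary x k"
    if "y \<in> trapped" for y k
  proof -
    have "(f ^^ k) y \<in> J 1 \<union> J 2"
      using that unfolding trapped_def by blast
    then show ?thesis
      using disjoint by (auto simp: itinerary_def numeral_eq_Suc)
  qed
  show "\<exists>U. openin (top_of_set trapped) U \<and> x \<in> U \<and>
          (\<forall>y\<in>U. itinerary y \<in> Metric_space.mball Sigma2 seq_dist (itinerary x) \<epsilon>)"
  proof (intro exI conjI ballI)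
    show "openin (top_of_set trapped) (trapped \<inter> U)"
      using \<open>open U\<close> by (rule openin_open_Int)
    show "x \<in> trapped \<inter> U"
      using x other[OF x] by (auto simp: U_def)
    fix y assume y: "y \<in> trapped \<inter> U"
    then have "itinerary x k = itinerary y k" if "k < n" for k
      using other[of y k] that by (auto simp: U_def)
    then have "seq_dist (itinerary x) (itinerary y) \<le> 2 * (1/2) ^ n"
      by (rule seq_dist_le)
    with n have "seq_dist (itinerary x) (itinerary y) < \<epsilon>"
      by linarith
    then show "itinerary y \<in> Metric_space.mball Sigma2 seq_dist (itinerary x) \<epsilon>"
      by (simp add: Metric_space.in_mball[OF Metric_space_Sigma2] itinerary_in_Sigma2)
  qed
qed

theorem conjugate_to_shift:
  "topologically_conjugate (top_of_set trapped) f Sigma2_topology shift"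
  unfolding topologically_conjugate_def
proof (intro conjI exI ballI)
  show "f \<in> topspace (top_of_set trapped) \<rightarrow> topspace (top_of_set trapped)"
    using image_in_trapped by auto
  show "shift \<in> topspace Sigma2_topology \<rightarrow> topspace Sigma2_topology"
    by (auto simp: shift_def Sigma2_def)
  show "homeomorphic_map (top_of_set trapped) Sigma2_topology itinerary"
  proof (rule continuous_imp_homeomorphic_map[OF itinerary_continuous])
    show "compact_space (top_of_set trapped)"
      using compact_trapped by (simp add: compact_space_subtopology)
    show "Hausdorff_space Sigma2_topology"
      unfolding Sigma2_topology_def
      by (rule Metric_space.Hausdorff_space_mtopology[OF Metric_space_Sigma2])
    show "itinerary ` topspace (top_of_set trapped) = topspace Sigma2_topology"
      using itinerary_in_Sigma2 itinerary_surj by (auto simp: image_iff) metis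
  qed (use itinerary_inj in simp)
qed (rule itinerary_image)

end

lemma hyperbolic_setI:
  fixes f f' :: "real \<Rightarrow> real"
  assumes deriv: "\<And>x. (f has_real_derivative f' x) (at x)" and "continuous_on UNIV f'"
    and "compact \<Lambda>" and inv: "f ` \<Lambda> = \<Lambda>"
    and "1 < \<mu>" and expand: "\<And>x. x \<in> \<Lambda> \<Longrightarrow> \<mu> \<le> \<bar>f' x\<bar>"
  shows "hyperbolic_set f \<Lambda>"
proof -
  have iterate: "\<exists>D. (f ^^ n has_real_derivative D) (at x) \<and> \<mu> ^ n \<le> \<bar>D\<bar>" if "x \<in> \<Lambda>" for n x
    using that
  proof (induction n arbitrary: x)
    case 0
    have "(f ^^ 0 has_real_derivative 1) (at x)"
      by (simp add: id_def)
    moreover have "\<mu> ^ 0 \<le> \<bar>1\<bar>"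
      by simp
    ultimately show ?case by blast
  next
    case (Suc n)
    have "f x \<in> \<Lambda>"
      using Suc.prems inv by blast
    then obtain D where D: "(f ^^ n has_real_derivative D) (at (f x))" "\<mu> ^ n \<le> \<bar>D\<bar>"
      using Suc.IH by blast
    have "(f ^^ Suc n has_real_derivative D * f' x) (at x)"
      using DERIV_chain[OF D(1) deriv] by (simp only: funpow_Suc_right)
    moreover have "\<mu> ^ Suc n \<le> \<bar>D * f' x\<bar>"
      using mult_mono[OF D(2) expand[OF Suc.prems]] \<open>1 < \<mu>\<close> by (simp add: abs_mult mult.commute)
    ultimately show ?case by blast
  qed
  have "\<mu> ^ n \<le> \<bar>deriv (f ^^ n) x\<bar>" if "x \<in> \<Lambda>" for n x
    using iterate[OF that, of n] by (auto simp: DERIV_imp_deriv)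
  then have "\<exists>C \<mu>::real. C > 0 \<and> \<mu> > 1 \<and>
      (\<forall>x\<in>\<Lambda>. \<forall>n\<ge>1. C * \<mu> ^ n \<le> \<bar>deriv (f ^^ n) x\<bar>)"
    using \<open>1 < \<mu>\<close> by (intro exI[of _ 1] exI[of _ \<mu>]) auto
  moreover have "f C1_differentiable_on UNIV"
    unfolding C1_differentiable_on_def
    using deriv assms(2) has_real_derivative_iff_has_vector_derivative by blast
  ultimately show ?thesis
    using assms unfolding hyperbolic_set_def invariant_set_def by blast
qed

section \<open>A horseshoe at a zero whose neighbourhood is stretched enough\<close>

text \<open>
  The growth condition is \<open>w' / w \<ge> 1 / (2 * t)\<close>, the logarithmic derivative of a square root.
  It makes \<open>w\<close> nondecreasing, so to the right of \<open>s\<close> the height stays above \<open>c\<close> and the slope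
  \<open>w' \<ge> w / (2 * t)\<close> stays above \<open>c / (2 * \<delta>)\<close>.
\<close>

lemma steep_above_height:
  fixes w w' :: "real \<Rightarrow> real"
  assumes deriv: "\<And>t. (w has_real_derivative w' t) (at t)"
    and grow: "\<And>t. 0 < t \<Longrightarrow> t \<le> \<delta> \<Longrightarrow> w t \<le> 2 * t * w' t"
    and pos: "\<And>t. 0 < t \<Longrightarrow> t \<le> \<delta> \<Longrightarrow> 0 < w t"
    and st: "0 < s" "s \<le> t" "t \<le> \<delta>" and c: "0 \<le> c" "c \<le> w s"
  shows "c / (2 * \<delta>) * (t - s) \<le> w t - w s"
proof (cases "s = t")
  case False
  then have "s < t" using st by simp
  have slope: "w r / (2 * r) \<le> w' r" if "0 < r" "r \<le> \<delta>" for r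
    using grow[OF that] that by (simp add: field_simps)
  obtain r where r: "s < r" "r < t" "w t - w s = (t - s) * w' r"
    using MVT2[OF \<open>s < t\<close>, of w w'] deriv by blast
  have "w s \<le> w r"
  proof (rule DERIV_nonneg_imp_nondecreasing[of s r w])
    fix u assume u: "s \<le> u" "u \<le> r"
    then have "0 < u" "u \<le> \<delta>" using st r by auto
    then have "0 \<le> w' u"
      using pos[of u] by (intro order_trans[OF _ slope[of u]]) auto
    then show "\<exists>y. (w has_real_derivative y) (at u) \<and> 0 \<le> y"
      using deriv by blast
  qed (use r in simp)
  then have "c / (2 * \<delta>) \<le> w r / (2 * r)"
    using c r st by (intro frac_le) auto
  also have "\<dots> \<le> w' r"
    using slope[of r] r st by simp
  finally have "c / (2 * \<delta>) * (t - s) \<le> w' r * (t - s)"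
    using \<open>s < t\<close> by (intro mult_right_mono) auto
  then show ?thesis
    unfolding r(3) by (simp only: mult.commute)
qed simp

text \<open>
  The factor \<open>(-1) ^ i\<close> selects the left half of the window for \<open>i = 1\<close> and the right half for
  \<open>i = 2\<close>, and turns \<open>x - \<alpha>\<close> into the distance from \<open>\<alpha>\<close> on that half.
\<close>

definition returning_half :: "(real \<Rightarrow> real) \<Rightarrow> real \<Rightarrow> real \<Rightarrow> nat \<Rightarrow> real set" where
  "returning_half f \<alpha> \<delta> i = {x. (-1) ^ i * (x - \<alpha>) \<in> {0..\<delta>} \<and> f x \<in> cball \<alpha> \<delta>}"

lemma returning_half_subset: "i \<in> {1, 2} \<Longrightarrow> returning_half f \<alpha> \<delta> i \<subseteq> cball \<alpha> \<delta>"
  by (auto simp: returning_half_def dist_real_def)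

text \<open>
  Both halves are treated at once: in the coordinate \<open>t = \<bar>x - \<alpha>\<bar>\<close> on half \<open>i\<close> the
  function \<open>\<bar>f\<bar> = sgn \<alpha> * f\<close> becomes a function \<open>w\<close> growing from \<open>0\<close> to at least \<open>2 * \<bar>\<alpha>\<bar>\<close>, and the points
  returning to the window have height \<open>w t \<ge> \<bar>\<alpha>\<bar> - \<delta> \<ge> 4 * \<delta>\<close>.  There the slope is at
  least \<open>4 * \<delta> / (2 * \<delta>) = 2\<close>.
\<close>

lemma horseshoe_at_zero:
  fixes f f' :: "real \<Rightarrow> real"
  assumes "\<alpha> \<noteq> 0" and "0 < \<delta>" and small: "5 * \<delta> \<le> \<bar>\<alpha>\<bar>"
    and zero: "f \<alpha> = 0"
    and deriv: "\<And>x. (f has_real_derivative f' x) (at x)"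
    and sign: "\<And>x. 0 \<le> \<alpha> * f x"
    and steep: "\<And>x. x \<noteq> \<alpha> \<Longrightarrow> \<bar>x - \<alpha>\<bar> \<le> \<delta> \<Longrightarrow> f x \<noteq> 0 \<and> 1/2 \<le> (x - \<alpha>) * f' x / f x"
    and high: "2 * \<bar>\<alpha>\<bar> \<le> \<bar>f (\<alpha> - \<delta>)\<bar>" "2 * \<bar>\<alpha>\<bar> \<le> \<bar>f (\<alpha> + \<delta>)\<bar>"
  shows "horseshoe f (returning_half f \<alpha> \<delta>) 2"
    and "\<And>i x. i \<in> {1, 2} \<Longrightarrow> x \<in> returning_half f \<alpha> \<delta> i \<Longrightarrow> 2 \<le> \<bar>f' x\<bar>"
proof -
  let ?J = "returning_half f \<alpha> \<delta>"
  have cont: "continuous_on UNIV f"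
    using deriv by (meson DERIV_continuous continuous_at_imp_continuous_on)
  have abs_f: "sgn \<alpha> * f x = \<bar>f x\<bar>" for x
    using sign[of x] \<open>\<alpha> \<noteq> 0\<close> by (auto simp: sgn_if zero_le_mult_iff)
  have away: "4 * \<delta> \<le> \<bar>y\<bar>" if "y \<in> cball \<alpha> \<delta>" for y
    using that small by (auto simp: dist_real_def)

  have cover_expand: "cball \<alpha> \<delta> \<subseteq> f ` ?J i \<and>
      (\<forall>x\<in>?J i. \<forall>y\<in>?J i. 2 * dist x y \<le> dist (f x) (f y)) \<and> compact (?J i)"
    if i: "i \<in> {1, 2}" for i
  proof -
    define e :: real where "e = (-1) ^ i"
    have e: "e = 1 \<or> e = -1"
      using i by (auto simp: e_def)
    then have ee: "e * e = 1" by auto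
    define w where "w t = sgn \<alpha> * f (\<alpha> + e * t)" for t
    define w' where "w' t = sgn \<alpha> * (f' (\<alpha> + e * t) * e)" for t
    have w_abs: "w t = \<bar>f (\<alpha> + e * t)\<bar>" for t
      unfolding w_def by (rule abs_f)
    have dw: "(w has_real_derivative w' t) (at t)" for t
      unfolding w_def w'_def
      by (rule derivative_eq_intros DERIV_chain2[OF deriv] refl | simp)+
    have w_pos: "0 < w t" and w_grow: "w t \<le> 2 * t * w' t" if "0 < t" "t \<le> \<delta>" for t
    proof -
      let ?x = "\<alpha> + e * t"
      have x: "?x \<noteq> \<alpha>" "\<bar>?x - \<alpha>\<bar> \<le> \<delta>"
        using that e by auto
      note st = steep[OF x]
      show "0 < w t"
        using st by (simp add: w_abs)
      then have "1/2 * w t \<le> (e * t * f' ?x / f ?x) * w t"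
        using st by (intro mult_right_mono) auto
      also have "\<dots> = t * w' t"
        using st by (simp add: w_def w'_def field_simps)
      finally show "w t \<le> 2 * t * w' t" by simp
    qed
    have cover: "y \<in> f ` ?J i" if y: "y \<in> cball \<alpha> \<delta>" for y
    proof -
      have "sgn \<alpha> * y = \<bar>y\<bar>" and "\<bar>y\<bar> \<le> 2 * \<bar>\<alpha>\<bar>"
        using y small \<open>\<alpha> \<noteq> 0\<close> \<open>0 < \<delta>\<close> by (auto simp: dist_real_def sgn_if)
      moreover have "2 * \<bar>\<alpha>\<bar> \<le> w \<delta>"
        using high e by (auto simp: w_abs)
      moreover have "w 0 = 0"
        by (simp add: w_def zero)
      moreover have "continuous_on {0..\<delta>} w"
        using dw by (meson DERIV_continuous continuous_at_imp_continuous_on)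
      ultimately obtain t where t: "0 \<le> t" "t \<le> \<delta>" "w t = sgn \<alpha> * y"
        using IVT'[of w 0 "sgn \<alpha> * y" \<delta>] \<open>0 < \<delta>\<close> by auto
      then have "f (\<alpha> + e * t) = y"
        using \<open>\<alpha> \<noteq> 0\<close> by (simp add: w_def sgn_zero_iff)
      moreover have "e * (\<alpha> + e * t - \<alpha>) = t"
        using e by auto
      ultimately have "\<alpha> + e * t \<in> ?J i"
        using t y unfolding returning_half_def e_def[symmetric] mem_Collect_eq atLeastAtMost_iff
        by presburger
      with \<open>f (\<alpha> + e * t) = y\<close> show ?thesis
        by blast
    qed
    have coord: "\<exists>t. x = \<alpha> + e * t \<and> 0 < t \<and> t \<le> \<delta> \<and> 4 * \<delta> \<le> w t" if x: "x \<in> ?J i" for x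
    proof (intro exI conjI)
      let ?t = "e * (x - \<alpha>)"
      have t: "0 \<le> ?t" "?t \<le> \<delta>" and fx: "f x \<in> cball \<alpha> \<delta>"
        using x by (auto simp: returning_half_def e_def)
      show eq: "x = \<alpha> + e * ?t"
        using ee by (simp flip: mult.assoc)
      show "4 * \<delta> \<le> w ?t"
        using away[OF fx] eq by (simp add: w_abs)
      then have "w ?t \<noteq> 0" using \<open>0 < \<delta>\<close> by simp
      then have "?t \<noteq> 0"
        using zero by (auto simp: w_def)
      then show "0 < ?t" using t(1) by linarith
    qed (use x in \<open>simp add: returning_half_def e_def\<close>)
    have expand: "2 * dist x y \<le> dist (f x) (f y)" if xy: "x \<in> ?J i" "y \<in> ?J i" for x y
    proof -
      obtain s where s: "x = \<alpha> + e * s" "0 < s" "s \<le> \<delta>" "4 * \<delta> \<le> w s"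
        using coord[OF xy(1)] by blast
      obtain t where t: "y = \<alpha> + e * t" "0 < t" "t \<le> \<delta>" "4 * \<delta> \<le> w t"
        using coord[OF xy(2)] by blast
      have dist_xy: "dist x y = \<bar>s - t\<bar>"
        using e s t by (auto simp: dist_real_def)
      have "dist (f x) (f y) = \<bar>sgn \<alpha> * (f x - f y)\<bar>"
        using \<open>\<alpha> \<noteq> 0\<close> by (simp add: dist_real_def abs_mult abs_sgn_eq)
      also have "\<dots> = \<bar>w s - w t\<bar>"
        using s t by (simp add: w_def algebra_simps)
      finally have dist_f: "dist (f x) (f y) = \<bar>w s - w t\<bar>" .
      have mono: "2 * (v - u) \<le> w v - w u"
        if "0 < u" "u \<le> v" "v \<le> \<delta>" "4 * \<delta> \<le> w u" for u v
        using steep_above_height[of w w' \<delta> u v "4 * \<delta>", OF dw w_grow w_pos that(1-3)] that(4) \<open>0 < \<delta>\<close>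
        by simp
      show ?thesis
        unfolding dist_xy dist_f using mono[of s t] mono[of t s] s t
        by (cases "s \<le> t") auto
    qed
    have "closed {x. e * (x - \<alpha>) \<in> {0..\<delta>} \<and> f x \<in> cball \<alpha> \<delta>}"
    proof -
      have "closed ((\<lambda>x. e * (x - \<alpha>)) -` {0..\<delta>} \<inter> f -` cball \<alpha> \<delta>)"
        by (intro closed_Int closed_vimage cont continuous_intros) auto
      then show ?thesis
        by (simp only: vimage_def Collect_conj_eq)
    qed
    then have "closed (?J i)"
      by (simp add: returning_half_def e_def)
    then have "compact (?J i)"
      using compact_Int_closed[OF compact_cball, of "?J i" \<alpha> \<delta>] returning_half_subset[OF i]
      by (simp add: Int_absorb1)
    with cover expand show ?thesis by blast
  qed

  have zero_out: "\<alpha> \<notin> ?J i" for i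
    using away[of 0] zero \<open>0 < \<delta>\<close> by (auto simp: returning_half_def)
  show "horseshoe f ?J 2"
  proof
    show "?J 1 \<inter> ?J 2 = {}"
    proof (rule ccontr)
      assume "?J 1 \<inter> ?J 2 \<noteq> {}"
      then obtain x where "x \<in> ?J 1" "x \<in> ?J 2" by blast
      then have "x = \<alpha>"
        by (auto simp: returning_half_def)
      with \<open>x \<in> ?J 1\<close> zero_out show False by blast
    qed
    have "\<alpha> \<in> cball \<alpha> \<delta>" using \<open>0 < \<delta>\<close> by simp
    then show "?J 1 \<union> ?J 2 \<noteq> {}"
      using cover_expand[of 1] by auto
    fix i :: nat assume i: "i \<in> {1, 2}"
    show "compact (?J i)"
      using cover_expand[OF i] by blast
    show "?J 1 \<union> ?J 2 \<subseteq> f ` ?J i"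
      using cover_expand[OF i] returning_half_subset[of 1 f \<alpha> \<delta>] returning_half_subset[of 2 f \<alpha> \<delta>]
      by blast
    fix x y assume "x \<in> ?J i" "y \<in> ?J i"
    then show "2 * dist x y \<le> dist (f x) (f y)"
      using cover_expand[OF i] by blast
  qed (use cont in auto)

  show "2 \<le> \<bar>f' x\<bar>" if i: "i \<in> {1, 2}" and x: "x \<in> ?J i" for i x
  proof -
    have x_near: "x \<noteq> \<alpha>" "\<bar>x - \<alpha>\<bar> \<le> \<delta>"
      using x zero_out returning_half_subset[OF i, of f \<alpha> \<delta>] by (auto simp: dist_real_def)
    have "4 * \<delta> \<le> \<bar>f x\<bar>"
      using x away by (auto simp: returning_half_def)
    also have "\<dots> \<le> 2 * (\<bar>x - \<alpha>\<bar> * \<bar>f' x\<bar>)"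
    proof -
      have "1/2 \<le> \<bar>(x - \<alpha>) * f' x / f x\<bar>" and "0 < \<bar>f x\<bar>"
        using steep[OF x_near] by linarith+
      then have "1/2 * \<bar>f x\<bar> \<le> \<bar>x - \<alpha>\<bar> * \<bar>f' x\<bar>"
        by (simp only: abs_mult abs_divide pos_le_divide_eq)
      then show ?thesis by linarith
    qed
    also have "\<dots> \<le> 2 * (\<delta> * \<bar>f' x\<bar>)"
      using x_near by (simp add: mult_right_mono)
    finally show ?thesis
      using \<open>0 < \<delta>\<close> by simp
  qed
qed

section \<open>Large multiples of a polynomial\<close>

text \<open>
  With \<open>g = (x - \<alpha>)\<^sup>k * h\<close> and \<open>h \<alpha> \<noteq> 0\<close>, the quotient equals \<open>k + (x - \<alpha>) * h' / h\<close>
  off \<open>\<alpha>\<close> and near it.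
\<close>

lemma log_derivative_at_root:
  fixes g :: "real poly"
  assumes "g \<noteq> 0"
  shows "((\<lambda>x. (x - \<alpha>) * poly (pderiv g) x / poly g x) \<longlongrightarrow> of_nat (order \<alpha> g)) (at \<alpha>)"
proof -
  define k where "k = order \<alpha> g"
  obtain h where g: "g = [:- \<alpha>, 1:] ^ k * h" and "\<not> [:- \<alpha>, 1:] dvd h"
    using order_decomp[OF assms] unfolding k_def by blast
  then have h: "poly h \<alpha> \<noteq> 0"
    by (simp add: poly_eq_0_iff_dvd)
  have "poly (pderiv g) x * (x - \<alpha>) =
      (x - \<alpha>) ^ k * (of_nat k * poly h x + (x - \<alpha>) * poly (pderiv h) x)" for x
  proof (cases k)
    case (Suc m)
    show ?thesis
      unfolding g Suc pderiv_mult pderiv_power_Suc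
      by (simp add: pderiv_pCons algebra_simps)
  qed (simp add: g)
  then have num: "(x - \<alpha>) * poly (pderiv g) x =
      (x - \<alpha>) ^ k * (of_nat k * poly h x + (x - \<alpha>) * poly (pderiv h) x)" for x
    by (simp add: mult.commute)
  have den: "poly g x = (x - \<alpha>) ^ k * poly h x" for x
    by (simp add: g)
  have "((\<lambda>x. (of_nat k * poly h x + (x - \<alpha>) * poly (pderiv h) x) / poly h x) \<longlongrightarrow>
      (of_nat k * poly h \<alpha> + (\<alpha> - \<alpha>) * poly (pderiv h) \<alpha>) / poly h \<alpha>) (at \<alpha>)"
    using h by (intro tendsto_intros)
  then have "((\<lambda>x. (of_nat k * poly h x + (x - \<alpha>) * poly (pderiv h) x) / poly h x) \<longlongrightarrow> of_nat k)
      (at \<alpha>)"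
    using h by simp
  then show ?thesis
    unfolding k_def[symmetric]
    by (rule Lim_transform_eventually) (auto simp: num den eventually_at_filter)
qed

text \<open>
  The limit of the logarithmic derivative is the multiplicity, hence at least \<open>1\<close>, so the
  quotient exceeds \<open>1/2\<close> in a punctured neighbourhood.  As division by zero yields \<open>0\<close>, the same
  bound shows that \<open>g\<close> has no zero there.
\<close>

lemma steep_window_at_root:
  fixes g :: "real poly"
  assumes "g \<noteq> 0" and "poly g \<alpha> = 0" and "0 < r"
  obtains \<delta> where "0 < \<delta>" "\<delta> \<le> r"
    and "\<And>x. x \<noteq> \<alpha> \<Longrightarrow> \<bar>x - \<alpha>\<bar> \<le> \<delta> \<Longrightarrow>
      poly g x \<noteq> 0 \<and> 1/2 \<le> (x - \<alpha>) * poly (pderiv g) x / poly g x"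
proof -
  have "order \<alpha> g \<noteq> 0"
    using assms order_root by blast
  then have "1/2 < real (order \<alpha> g)" by simp
  from order_tendstoD(1)[OF log_derivative_at_root[OF assms(1)] this]
  obtain d where d: "0 < d"
    and near: "\<And>x. x \<noteq> \<alpha> \<Longrightarrow> dist x \<alpha> < d \<Longrightarrow> 1/2 < (x - \<alpha>) * poly (pderiv g) x / poly g x"
    unfolding eventually_at by auto
  show thesis
  proof
    show "0 < min r (d / 2)" "min r (d / 2) \<le> r"
      using d \<open>0 < r\<close> by auto
    fix x assume "x \<noteq> \<alpha>" "\<bar>x - \<alpha>\<bar> \<le> min r (d / 2)"
    then have "1/2 < (x - \<alpha>) * poly (pderiv g) x / poly g x"
      using near[of x] d by (simp add: dist_real_def)
    then show "poly g x \<noteq> 0 \<and> 1/2 \<le> (x - \<alpha>) * poly (pderiv g) x / poly g x"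
      by (auto intro: ccontr)
  qed
qed

theorem large_multiples_have_horseshoe:
  fixes g :: "real poly"
  assumes "g \<noteq> 0" and root: "poly g \<alpha> = 0" and "\<alpha> \<noteq> 0"
  obtains N where "0 < N"
    and "\<And>a. N < \<bar>a\<bar> \<Longrightarrow> (\<And>x. 0 \<le> \<alpha> * scaled_poly g a x) \<Longrightarrow>
      \<exists>\<Lambda>. \<Lambda> \<subseteq> cball \<alpha> (\<bar>\<alpha>\<bar> / 5) - {\<alpha>} \<and> hyperbolic_set (scaled_poly g a) \<Lambda> \<and>
        topologically_conjugate (top_of_set \<Lambda>) (scaled_poly g a) Sigma2_topology shift"
proof -
  obtain \<delta> where \<delta>: "0 < \<delta>" "\<delta> \<le> \<bar>\<alpha>\<bar> / 5"
    and steep: "\<And>x. x \<noteq> \<alpha> \<Longrightarrow> \<bar>x - \<alpha>\<bar> \<le> \<delta> \<Longrightarrow>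
      poly g x \<noteq> 0 \<and> 1/2 \<le> (x - \<alpha>) * poly (pderiv g) x / poly g x"
    using steep_window_at_root[OF assms(1,2), of "\<bar>\<alpha>\<bar> / 5"] \<open>\<alpha> \<noteq> 0\<close> by auto
  define m where "m = min \<bar>poly g (\<alpha> - \<delta>)\<bar> \<bar>poly g (\<alpha> + \<delta>)\<bar>"
  have m: "0 < m"
    using steep[of "\<alpha> - \<delta>"] steep[of "\<alpha> + \<delta>"] \<delta> by (auto simp: m_def)
  show thesis
  proof
    \<comment> \<open>this threshold makes \<open>\<bar>f\<bar>\<close> at least \<open>2 * \<bar>\<alpha>\<bar>\<close>, a bound on the whole window, at both of its ends\<close>
    show N: "0 < 2 * \<bar>\<alpha>\<bar> / m"
      using m \<open>\<alpha> \<noteq> 0\<close> by simp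
    fix a assume a: "2 * \<bar>\<alpha>\<bar> / m < \<bar>a\<bar>" and sign: "\<And>x. 0 \<le> \<alpha> * scaled_poly g a x"
    let ?f = "scaled_poly g a" and ?f' = "\<lambda>x. a * poly (pderiv g) x"
    let ?J = "returning_half ?f \<alpha> \<delta>"
    have "a \<noteq> 0" using a N by auto
    have deriv: "(?f has_real_derivative ?f' x) (at x)" for x
      unfolding scaled_poly_def by (intro DERIV_cmult poly_DERIV)
    have "2 * \<bar>\<alpha>\<bar> \<le> \<bar>a\<bar> * m"
      using a m by (simp add: field_simps)
    then have high: "2 * \<bar>\<alpha>\<bar> \<le> \<bar>?f x\<bar>" if "m \<le> \<bar>poly g x\<bar>" for x
      using mult_left_mono[OF that, of "\<bar>a\<bar>"] by (simp add: scaled_poly_def abs_mult)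
    have steep': "?f x \<noteq> 0 \<and> 1/2 \<le> (x - \<alpha>) * ?f' x / ?f x" if "x \<noteq> \<alpha>" "\<bar>x - \<alpha>\<bar> \<le> \<delta>" for x
      using steep[OF that] \<open>a \<noteq> 0\<close> by (simp add: scaled_poly_def)
    have "5 * \<delta> \<le> \<bar>\<alpha>\<bar>" using \<delta> by simp
    have "?f \<alpha> = 0" by (simp add: scaled_poly_def root)
    have high': "2 * \<bar>\<alpha>\<bar> \<le> \<bar>?f (\<alpha> - \<delta>)\<bar>" "2 * \<bar>\<alpha>\<bar> \<le> \<bar>?f (\<alpha> + \<delta>)\<bar>"
      by (rule high; simp add: m_def)+
    note window = \<open>\<alpha> \<noteq> 0\<close> \<open>0 < \<delta>\<close> \<open>5 * \<delta> \<le> \<bar>\<alpha>\<bar>\<close> \<open>?f \<alpha> = 0\<close> deriv sign steep' high'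
    interpret horseshoe ?f ?J 2
      by (rule horseshoe_at_zero(1)[OF window])
    have in_piece: "\<exists>i\<in>{1, 2}. x \<in> ?J i" if "x \<in> trapped" for x
      using that trapped_subset by auto
    have "\<alpha> \<notin> trapped"
    proof
      assume "\<alpha> \<in> trapped"
      then obtain i where "\<alpha> \<in> ?J i" using in_piece by blast
      then show False
        using \<open>?f \<alpha> = 0\<close> \<delta> \<open>\<alpha> \<noteq> 0\<close> by (auto simp: returning_half_def dist_real_def)
    qed
    moreover have "trapped \<subseteq> cball \<alpha> \<delta>"
      using in_piece returning_half_subset by blast
    ultimately have "trapped \<subseteq> cball \<alpha> (\<bar>\<alpha>\<bar> / 5) - {\<alpha>}"
      using \<delta> subset_cball[of \<delta> "\<bar>\<alpha>\<bar> / 5" \<alpha>] by blast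
    moreover have "hyperbolic_set ?f trapped"
    proof (rule hyperbolic_setI[OF deriv _ compact_trapped image_trapped])
      show "continuous_on UNIV ?f'"
        by (intro continuous_intros)
      show "2 \<le> \<bar>?f' x\<bar>" if "x \<in> trapped" for x
        using in_piece[OF that] horseshoe_at_zero(2)[OF window] by blast
    qed simp
    ultimately show "\<exists>\<Lambda>. \<Lambda> \<subseteq> cball \<alpha> (\<bar>\<alpha>\<bar> / 5) - {\<alpha>} \<and> hyperbolic_set ?f \<Lambda> \<and>
        topologically_conjugate (top_of_set \<Lambda>) ?f Sigma2_topology shift"
      using conjugate_to_shift by blast
  qed
qed

theorem theorem4p2:
  fixes g :: "real poly" and \<alpha> :: real
  assumes "{x. poly g x = 0} = {\<alpha>}"
  shows "(\<alpha> > 0 \<longrightarrow>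
           (\<exists>N>0. \<forall>a. \<bar>a\<bar> > N \<and> (\<forall>x. scaled_poly g a x \<ge> 0) \<longrightarrow>
              (\<exists>\<Lambda>. \<Lambda> \<subseteq> {0<..<\<alpha>} \<union> {\<alpha><..} \<and>
                   hyperbolic_set (scaled_poly g a) \<Lambda> \<and>
                   topologically_conjugate (top_of_set \<Lambda>) (scaled_poly g a)
                     Sigma2_topology shift))) \<and>
         (\<alpha> < 0 \<longrightarrow>
           (\<exists>N>0. \<forall>a. \<bar>a\<bar> > N \<and> (\<forall>x. scaled_poly g a x \<le> 0) \<longrightarrow>
              (\<exists>\<Lambda>. \<Lambda> \<subseteq> {..<\<alpha>} \<union> {\<alpha><..<0} \<and>
                   hyperbolic_set (scaled_poly g a) \<Lambda> \<and>
                   topologically_conjugate (top_of_set \<Lambda>) (scaled_poly g a)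
                     Sigma2_topology shift)))"
proof -
  have root: "poly g \<alpha> = 0"
    using assms by blast
  have "poly g (\<alpha> + 1) \<noteq> 0"
    using assms by (auto simp: set_eq_iff)
  then have "g \<noteq> 0" by auto
  have main: "\<exists>N>0. \<forall>a. \<bar>a\<bar> > N \<and> (\<forall>x. P (scaled_poly g a x)) \<longrightarrow>
      (\<exists>\<Lambda>. \<Lambda> \<subseteq> S \<and> hyperbolic_set (scaled_poly g a) \<Lambda> \<and>
        topologically_conjugate (top_of_set \<Lambda>) (scaled_poly g a) Sigma2_topology shift)"
    if "\<alpha> \<noteq> 0" and P: "\<And>y. P y \<Longrightarrow> 0 \<le> \<alpha> * y" and S: "cball \<alpha> (\<bar>\<alpha>\<bar> / 5) - {\<alpha>} \<subseteq> S"
    for P :: "real \<Rightarrow> bool" and S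
  proof -
    obtain N where "0 < N"
      and N: "\<And>a. N < \<bar>a\<bar> \<Longrightarrow> (\<And>x. 0 \<le> \<alpha> * scaled_poly g a x) \<Longrightarrow>
        \<exists>\<Lambda>. \<Lambda> \<subseteq> cball \<alpha> (\<bar>\<alpha>\<bar> / 5) - {\<alpha>} \<and> hyperbolic_set (scaled_poly g a) \<Lambda> \<and>
          topologically_conjugate (top_of_set \<Lambda>) (scaled_poly g a) Sigma2_topology shift"
      using large_multiples_have_horseshoe[OF \<open>g \<noteq> 0\<close> root \<open>\<alpha> \<noteq> 0\<close>] by blast
    show ?thesis
    proof (intro exI[of _ N] conjI allI impI)
      fix a assume a: "N < \<bar>a\<bar> \<and> (\<forall>x. P (scaled_poly g a x))"
      then have "0 \<le> \<alpha> * scaled_poly g a x" for x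
        using P by blast
      from N[OF conjunct1[OF a] this]
      show "\<exists>\<Lambda>. \<Lambda> \<subseteq> S \<and> hyperbolic_set (scaled_poly g a) \<Lambda> \<and>
          topologically_conjugate (top_of_set \<Lambda>) (scaled_poly g a) Sigma2_topology shift"
        using S by (meson order_trans)
    qed fact
  qed
  show ?thesis
  proof (intro conjI impI)
    assume "0 < \<alpha>"
    then show "\<exists>N>0. \<forall>a. \<bar>a\<bar> > N \<and> (\<forall>x. scaled_poly g a x \<ge> 0) \<longrightarrow>
        (\<exists>\<Lambda>. \<Lambda> \<subseteq> {0<..<\<alpha>} \<union> {\<alpha><..} \<and> hyperbolic_set (scaled_poly g a) \<Lambda> \<and>
          topologically_conjugate (top_of_set \<Lambda>) (scaled_poly g a) Sigma2_topology shift)"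
      by (intro main) (auto simp: dist_real_def)
  next
    assume "\<alpha> < 0"
    then show "\<exists>N>0. \<forall>a. \<bar>a\<bar> > N \<and> (\<forall>x. scaled_poly g a x \<le> 0) \<longrightarrow>
        (\<exists>\<Lambda>. \<Lambda> \<subseteq> {..<\<alpha>} \<union> {\<alpha><..<0} \<and> hyperbolic_set (scaled_poly g a) \<Lambda> \<and>
          topologically_conjugate (top_of_set \<Lambda>) (scaled_poly g a) Sigma2_topology shift)"
      by (intro main) (auto simp: dist_real_def mult_nonpos_nonpos)
  qed
qed

end
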